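(* For every integer $n>1$, $$\det[j-k+\delta_{jk}]_{1\le j,k\le n}=1+\frac{n^2(n^2-1)}{12}.$$
   Context: $\delta_{jk}$ is the Kronecker delta: it is $1$ if $j=k$ and $0$ otherwise. $\det[a_{jk}]_{1\le j,k\le n}$ is the determinant of the $n\times n$ matrix with $(j,k)$-entry $a_{jk}$. *)

theory Defs
  imports Complex_Main "Jordan_Normal_Form.Determinant"
begin

(* Matrices of Jordan_Normal_Form are indexed from 0; a is indexed from 1 to n. *)
definition det_1n :: "nat \<Rightarrow> (nat \<Rightarrow> nat \<Rightarrow> 'a :: comm_ring_1) \<Rightarrow> 'a" where
  "det_1n n a = det (mat n n (\<lambda>(i, l). a (i + 1) (l + 1)))"

definition kronecker_delta :: "nat \<Rightarrow> nat \<Rightarrow> 'a :: zero_neq_one" where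
  "kronecker_delta j k = (if j = k then 1 else 0)"

end

theory Submission imports Defs begin

text \<open>
  The matrix is a rank-two perturbation of the identity: \<open>j - k = j * 1 + 1 * (- k)\<close>, so it has
  the form \<open>I + U * V\<close>, where the two columns of \<open>U\<close> are \<open>(j)\<close> and \<open>(1)\<close> and the two rows of
  \<open>V\<close> are \<open>(1)\<close> and \<open>(- k)\<close>.  The Weinstein--Aronszajn identity \<open>det_one_plus_mult_commute\<close>
  replaces its determinant by that of the \<open>2\<close> by \<open>2\<close> matrix \<open>I + V * U\<close>, whose entries are power
  sums of \<open>1, ..., n\<close>.  With \<open>s = \<Sum> k\<close> and \<open>q = \<Sum> k\<^sup>2\<close> the latter determinant equals
  \<open>(1 + s) * (1 - s) + n * q\<close>, and the closed forms of \<open>s\<close> and \<open>q\<close> give the result.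
\<close>

text \<open>
  Both sides are the determinant of the block matrix with rows \<open>(I, - U)\<close> and \<open>(V, I)\<close>:
  multiplying it by the unimodular matrix with rows \<open>(I, U)\<close> and \<open>(0, I)\<close> from the left clears
  the upper right block and leaves \<open>I + U * V\<close> in the upper left corner, while multiplying from the
  right clears the same block and leaves \<open>I + V * U\<close> in the lower right corner.
\<close>
lemma det_one_plus_mult_commute:
  fixes U V :: "'a :: idom mat"
  assumes U: "U \<in> carrier_mat n m" and V: "V \<in> carrier_mat m n"
  shows "det (1\<^sub>m n + U * V) = det (1\<^sub>m m + V * U)"
proof -
  define M where "M = four_block_mat (1\<^sub>m n) (- U) V (1\<^sub>m m)"
  define T where "T = four_block_mat (1\<^sub>m n) U (0\<^sub>m m n) (1\<^sub>m m)"
  have M: "M \<in> carrier_mat (n + m) (n + m)" and T: "T \<in> carrier_mat (n + m) (n + m)"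
    unfolding M_def T_def by auto
  have "T * M = four_block_mat (1\<^sub>m n * 1\<^sub>m n + U * V) (1\<^sub>m n * (- U) + U * 1\<^sub>m m)
      (0\<^sub>m m n * 1\<^sub>m n + 1\<^sub>m m * V) (0\<^sub>m m n * (- U) + 1\<^sub>m m * 1\<^sub>m m)"
    unfolding T_def M_def using U V by (intro mult_four_block_mat) auto
  also have "\<dots> = four_block_mat (1\<^sub>m n + U * V) (0\<^sub>m n m) V (1\<^sub>m m)"
    using U V by (intro cong_four_block_mat) (auto simp: uminus_l_inv_mat)
  finally have "det (T * M) = det (1\<^sub>m n + U * V)"
    using U V by (simp add: det_four_block_mat_upper_right_zero[where n = n and m = m])
  moreover have "M * T = four_block_mat (1\<^sub>m n * 1\<^sub>m n + (- U) * 0\<^sub>m m n) (1\<^sub>m n * U + (- U) * 1\<^sub>m m)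
      (V * 1\<^sub>m n + 1\<^sub>m m * 0\<^sub>m m n) (V * U + 1\<^sub>m m * 1\<^sub>m m)"
    unfolding T_def M_def using U V by (intro mult_four_block_mat) auto
  moreover have "\<dots> = four_block_mat (1\<^sub>m n) (0\<^sub>m n m) V (1\<^sub>m m + V * U)"
    using U V by (intro cong_four_block_mat) (auto intro!: comm_add_mat)
  ultimately have "det (M * T) = det (1\<^sub>m m + V * U)"
    using U V by (simp add: det_four_block_mat_upper_right_zero[where n = n and m = m])
  moreover have "det (T * M) = det (M * T)"
    using M T by (simp add: det_mult mult.commute)
  ultimately show ?thesis
    using \<open>det (T * M) = det (1\<^sub>m n + U * V)\<close> by simp
qed

lemma det_mat_2:
  fixes A :: "'a :: comm_ring_1 mat"
  assumes A: "A \<in> carrier_mat 2 2"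
  shows "det A = A $$ (0, 0) * A $$ (1, 1) - A $$ (0, 1) * A $$ (1, 0)"
proof -
  have del: "det (mat_delete A 0 0) = A $$ (1, 1)" "det (mat_delete A 0 1) = A $$ (1, 0)"
    using A by (auto simp: det_single mat_delete_def)
  have "det A = (\<Sum>j<2. A $$ (0, j) * cofactor A 0 j)"
    using A by (intro laplace_expansion_row) auto
  then show ?thesis
    using del by (simp add: cofactor_def numeral_2_eq_2)
qed

lemma sum_power2_upto:
  "(\<Sum>k<n. (real k + 1)\<^sup>2) = real n * (real n + 1) * (2 * real n + 1) / 6"
  by (induction n) (simp_all add: field_simps power2_eq_square)

lemma sum_upto:
  "(\<Sum>k<n. real k + 1) = real n * (real n + 1) / 2"
  by (induction n) (simp_all add: field_simps)

theorem mainTheorem2: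
  fixes n :: nat
  assumes "n > 1"
  shows "det_1n n (\<lambda>j k. real j - real k + kronecker_delta j k)
    = 1 + (real n)^2 * ((real n)^2 - 1) / 12"
proof -
  define U where "U = mat n 2 (\<lambda>(j, i). if i = 0 then real j + 1 else 1)"
  define V where "V = mat 2 n (\<lambda>(i, k). if i = 0 then 1 else - (real k + 1))"
  define s where "s = (\<Sum>k<n. real k + 1)"
  define q where "q = (\<Sum>k<n. (real k + 1)\<^sup>2)"
  have U: "U \<in> carrier_mat n 2" and V: "V \<in> carrier_mat 2 n"
    by (simp_all add: U_def V_def)
  have UV: "mat n n (\<lambda>(j, k). real (j + 1) - real (k + 1) + kronecker_delta (j + 1) (k + 1))
      = 1\<^sub>m n + U * V"
    by (rule eq_matI)
      (auto simp: U_def V_def scalar_prod_def kronecker_delta_def numeral_2_eq_2)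
  have neg: "(\<Sum>k<n. - real k - 1) = - s" "(\<Sum>k<n. (- real k - 1) * (real k + 1)) = - q"
    unfolding s_def q_def sum_negf[symmetric]
    by (auto intro!: sum.cong simp: power2_eq_square algebra_simps)
  have VU: "1\<^sub>m 2 + V * U = mat 2 2 (\<lambda>(i, j). if i = 0 then (if j = 0 then 1 + s else real n)
      else (if j = 0 then - q else 1 - s))"
    by (rule eq_matI)
      (auto simp: U_def V_def scalar_prod_def neg s_def[symmetric] less_2_cases_iff atLeast0LessThan)
  have "det_1n n (\<lambda>j k. real j - real k + kronecker_delta j k) = det (1\<^sub>m 2 + V * U)"
    using det_one_plus_mult_commute[OF U V] UV by (simp add: det_1n_def)
  also have "\<dots> = (1 + s) * (1 - s) + real n * q"
    unfolding VU by (subst det_mat_2) auto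
  also have "\<dots> = 1 + (real n)^2 * ((real n)^2 - 1) / 12"
    unfolding s_def q_def sum_upto sum_power2_upto by (simp add: field_simps power2_eq_square)
  finally show ?thesis .
qed

end
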